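(* Let $\mathcal{H}$ be a complex Hilbert space, $\Gamma:\mathcal{H}\to\mathcal{H}$ an anti-unitary involution, and let $S$ and $S'$ be covariance operators on $\mathcal{H}$ (with respect to $\Gamma$). If the couple $(S,S')$ has the affine property, then $(S\xi,\Gamma\xi)=(S'\xi,\Gamma\xi)$ holds for all $\xi\in\mathcal{H}$.
   Context: Let $\mathcal{H}$ be a complex Hilbert space with scalar product $(\cdot,\cdot)$, linear in the first variable, and $\Gamma:\mathcal{H}\to\mathcal{H}$ an anti-unitary involution (conjugate-linear, $\Gamma^2=\mathbf{1}$, $(\Gamma\xi,\Gamma\eta)=(\eta,\xi)$). The self-dual CAR algebra $A(\mathcal{H},\Gamma)$ is the universal $C^*$-algebra generated by $\{b(\xi)\mid\xi\in\mathcal{H}\}$ with relations: $b(\alpha\xi+\beta\eta)=\alpha b(\xi)+\beta b(\eta)$, $b(\Gamma\xi)=b(\xi)^*$, and $b(\xi)b(\eta)^*+b(\eta)^*b(\xi)=(\xi,\eta)\mathbf{1}$, for all $\alpha,\beta\in\mathbb{C}$, $\xi,\eta\in\mathcal{H}$. A state $\phi$ on $A(\mathcal{H},\Gamma)$ is called quasi-free if for all $\xi_1,\dots,\xi_k\in\mathcal{H}$ one has $\phi(b(\xi_1)\cdots b(\xi_k))=0$ when $k$ is odd, and, when $k=2n$, $$\phi(b(\xi_1)\cdots b(\xi_{2n}))=(-1)^{\frac{(n-1)n}{2}}\sum_{\sigma\in T_{2n}}\mathrm{sgn}(\sigma)\prod_{i=1}^n\phi(b(\xi_{\sigma(i)})b(\xi_{\sigma(i+n)})),$$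 where $T_{2n}=\{\sigma\in S_{2n}\mid\sigma(1)<\cdots<\sigma(n),\ \sigma(i)<\sigma(i+n)\ \text{for } i=1,\dots,n\}$ and $S_{2n}$ is the symmetric group. A covariance operator on $\mathcal{H}$ (with respect to $\Gamma$) is a bounded linear operator $S$ on $\mathcal{H}$ with $0\leq S\leq\mathbf{1}$ and $\Gamma S\Gamma=\mathbf{1}-S$. For every covariance operator $S$ there exists a unique quasi-free state, denoted $\phi_S$, on $A(\mathcal{H},\Gamma)$ satisfying $(S\xi,\eta)=\phi_S(b(\eta)^*b(\xi))$ for all $\xi,\eta\in\mathcal{H}$; this is a one-to-one correspondence between covariance operators and quasi-free states. For covariance operators $S,S'$ and $0\leq\lambda\leq1$, the operator $\lambda S+(1-\lambda)S'$ is again a covariance operator. The couple $(S,S')$ is said to have the affine property if $\phi_{\lambda S+(1-\lambda)S'}=\lambda\phi_S+(1-\lambda)\phi_{S'}$ for all $0\leq\lambda\leq1$. *)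

theory Defs
  imports
    "HOL-Analysis.Analysis"
    "HOL-Library.Poly_Mapping"
    "HOL-Library.Complex_Order"
    "HOL-Combinatorics.Permutations"
    "HOL-Algebra.Module"
begin

section \<open>Complex Hilbert spaces\<close>

text \<open>The scalar product is linear in the first variable. The real structure and the norm of the
  library class \<open>banach\<close> are tied to the complex scalar product.\<close>

class chilbert_space = banach +
  fixes scaleC :: "complex \<Rightarrow> 'a \<Rightarrow> 'a" (infixr \<open>*\<^sub>C\<close> 75)
    and cinner :: "'a \<Rightarrow> 'a \<Rightarrow> complex"
  assumes scaleC_of_real: "complex_of_real r *\<^sub>C x = r *\<^sub>R x"
    and scaleC_add_right: "a *\<^sub>C (x + y) = a *\<^sub>C x + a *\<^sub>C y"
    and scaleC_add_left: "(a + b) *\<^sub>C x = a *\<^sub>C x + b *\<^sub>C x"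
    and scaleC_scaleC: "a *\<^sub>C b *\<^sub>C x = (a * b) *\<^sub>C x"
    and cinner_add_left: "cinner (x + y) z = cinner x z + cinner y z"
    and cinner_scaleC_left: "cinner (a *\<^sub>C x) y = a * cinner x y"
    and cinner_commute: "cinner y x = cnj (cinner x y)"
    and cinner_norm: "cinner x x = complex_of_real ((norm x)\<^sup>2)"

instantiation complex :: chilbert_space
begin

definition "scaleC_complex = ((*) :: complex \<Rightarrow> complex \<Rightarrow> complex)"
definition "cinner_complex x y = x * cnj y" for x y :: complex

instance
  by standard
    (auto simp: scaleC_complex_def cinner_complex_def scaleR_conv_of_real algebra_simps
      complex_mult_cnj cmod_power2)

end

definition bounded_clinear :: "('h::chilbert_space \<Rightarrow> 'h) \<Rightarrow> bool" where
  "bounded_clinear T \<longleftrightarrow> bounded_linear T \<and> (\<forall>a x. T (a *\<^sub>C x) = a *\<^sub>C T x)"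

definition positive_operator :: "('h::chilbert_space \<Rightarrow> 'h) \<Rightarrow> bool" where
  "positive_operator T \<longleftrightarrow> bounded_clinear T \<and> (\<forall>\<xi>. 0 \<le> cinner (T \<xi>) \<xi>)"

definition antiunitary_involution :: "('h::chilbert_space \<Rightarrow> 'h) \<Rightarrow> bool" where
  "antiunitary_involution \<Gamma> \<longleftrightarrow>
     (\<forall>\<xi> \<eta>. \<Gamma> (\<xi> + \<eta>) = \<Gamma> \<xi> + \<Gamma> \<eta>) \<and>
     (\<forall>a \<xi>. \<Gamma> (a *\<^sub>C \<xi>) = cnj a *\<^sub>C \<Gamma> \<xi>) \<and>
     (\<forall>\<xi>. \<Gamma> (\<Gamma> \<xi>) = \<xi>) \<and>
     (\<forall>\<xi> \<eta>. cinner (\<Gamma> \<xi>) (\<Gamma> \<eta>) = cinner \<eta> \<xi>)"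

definition covariance_operator :: "('h::chilbert_space \<Rightarrow> 'h) \<Rightarrow> ('h \<Rightarrow> 'h) \<Rightarrow> bool" where
  "covariance_operator \<Gamma> S \<longleftrightarrow>
     bounded_clinear S \<and> positive_operator S \<and> positive_operator (\<lambda>\<xi>. \<xi> - S \<xi>) \<and>
     (\<forall>\<xi>. \<Gamma> (S (\<Gamma> \<xi>)) = \<xi> - S \<xi>)"


section \<open>Unital C*-algebras\<close>

record 'a cstar = "(complex, 'a) module" +
  adj :: "'a \<Rightarrow> 'a"
  cnorm :: "'a \<Rightarrow> real"

locale cstar_algebra = ring A for A :: "('a, 'm) cstar_scheme" (structure) +
  assumes smult_closed: "x \<in> carrier A \<Longrightarrow> c \<odot> x \<in> carrier A"
    and smult_add_left: "x \<in> carrier A \<Longrightarrow> (c + d) \<odot> x = c \<odot> x \<oplus> d \<odot> x"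
    and smult_add_right:
      "x \<in> carrier A \<Longrightarrow> y \<in> carrier A \<Longrightarrow> c \<odot> (x \<oplus> y) = c \<odot> x \<oplus> c \<odot> y"
    and smult_smult: "x \<in> carrier A \<Longrightarrow> c \<odot> (d \<odot> x) = (c * d) \<odot> x"
    and smult_one: "x \<in> carrier A \<Longrightarrow> 1 \<odot> x = x"
    and smult_mult_left: "x \<in> carrier A \<Longrightarrow> y \<in> carrier A \<Longrightarrow> (c \<odot> x) \<otimes> y = c \<odot> (x \<otimes> y)"
    and smult_mult_right: "x \<in> carrier A \<Longrightarrow> y \<in> carrier A \<Longrightarrow> x \<otimes> (c \<odot> y) = c \<odot> (x \<otimes> y)"
    and adj_closed: "x \<in> carrier A \<Longrightarrow> adj A x \<in> carrier A"
    and adj_adj: "x \<in> carrier A \<Longrightarrow> adj A (adj A x) = x"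
    and adj_add: "x \<in> carrier A \<Longrightarrow> y \<in> carrier A \<Longrightarrow> adj A (x \<oplus> y) = adj A x \<oplus> adj A y"
    and adj_smult: "x \<in> carrier A \<Longrightarrow> adj A (c \<odot> x) = cnj c \<odot> adj A x"
    and adj_mult: "x \<in> carrier A \<Longrightarrow> y \<in> carrier A \<Longrightarrow> adj A (x \<otimes> y) = adj A y \<otimes> adj A x"
    and cnorm_eq_0: "x \<in> carrier A \<Longrightarrow> cnorm A x = 0 \<longleftrightarrow> x = \<zero>"
    and cnorm_add:
      "x \<in> carrier A \<Longrightarrow> y \<in> carrier A \<Longrightarrow> cnorm A (x \<oplus> y) \<le> cnorm A x + cnorm A y"
    and cnorm_smult: "x \<in> carrier A \<Longrightarrow> cnorm A (c \<odot> x) = cmod c * cnorm A x"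
    and cnorm_mult:
      "x \<in> carrier A \<Longrightarrow> y \<in> carrier A \<Longrightarrow> cnorm A (x \<otimes> y) \<le> cnorm A x * cnorm A y"
    and cstar_identity: "x \<in> carrier A \<Longrightarrow> cnorm A (adj A x \<otimes> x) = (cnorm A x)\<^sup>2"
    and cnorm_complete:
      "(\<And>n. X n \<in> carrier A) \<Longrightarrow>
       (\<forall>e>0. \<exists>M. \<forall>m\<ge>M. \<forall>n\<ge>M. cnorm A (X m \<ominus> X n) < e) \<Longrightarrow>
       \<exists>x\<in>carrier A. (\<lambda>n::nat. cnorm A (X n \<ominus> x)) \<longlonglongrightarrow> 0"

text \<open>A state is a function on the carrier; it is made \<open>undefined\<close> outside, so that equality of
  states is equality of HOL functions.\<close>

definition state :: "('a, 'm) cstar_scheme \<Rightarrow> ('a \<Rightarrow> complex) \<Rightarrow> bool" where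
  "state A \<phi> \<longleftrightarrow>
     \<phi> \<in> extensional (carrier A) \<and>
     (\<forall>x\<in>carrier A. \<forall>y\<in>carrier A. \<phi> (x \<oplus>\<^bsub>A\<^esub> y) = \<phi> x + \<phi> y) \<and>
     (\<forall>c. \<forall>x\<in>carrier A. \<phi> (c \<odot>\<^bsub>A\<^esub> x) = c * \<phi> x) \<and>
     (\<forall>x\<in>carrier A. 0 \<le> \<phi> (adj A x \<otimes>\<^bsub>A\<^esub> x)) \<and>
     \<phi> \<one>\<^bsub>A\<^esub> = 1"


section \<open>Free unital *-algebras\<close>

text \<open>Words in the letters \<open>g\<close> (coded as \<open>(g, False)\<close>) and \<open>g\<^sup>*\<close> (coded as \<open>(g, True)\<close>). With
  concatenation as addition, the convolution product of finitely supported functions is the product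
  of noncommutative polynomials.\<close>

datatype 'g star_word = Star_Word (letters: "('g \<times> bool) list")

instantiation star_word :: (type) monoid_add
begin

definition "zero_star_word = Star_Word []"
definition "u + v = Star_Word (letters u @ letters v)" for u v :: "'a star_word"

instance by standard (auto simp: zero_star_word_def plus_star_word_def)

end

type_synonym 'g free_star_algebra = "'g star_word \<Rightarrow>\<^sub>0 complex"

definition word_adj :: "'g star_word \<Rightarrow> 'g star_word" where
  "word_adj w = Star_Word (rev (map (\<lambda>(g, s). (g, \<not> s)) (letters w)))"

definition free_gen :: "'g \<Rightarrow> 'g free_star_algebra" where
  "free_gen g = Poly_Mapping.single (Star_Word [(g, False)]) 1"

definition free_scale :: "complex \<Rightarrow> 'g free_star_algebra \<Rightarrow> 'g free_star_algebra" where
  "free_scale c x = Poly_Mapping.map ((*) c) x"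

definition free_adj :: "'g free_star_algebra \<Rightarrow> 'g free_star_algebra" where
  "free_adj x = Poly_Mapping.map_key word_adj (Poly_Mapping.map cnj x)"


section \<open>The universal C*-algebra of a set of relations\<close>

definition cstar_seminorm :: "('g free_star_algebra \<Rightarrow> real) \<Rightarrow> bool" where
  "cstar_seminorm p \<longleftrightarrow>
     (\<forall>x y. p (x + y) \<le> p x + p y) \<and>
     (\<forall>c x. p (free_scale c x) = cmod c * p x) \<and>
     (\<forall>x y. p (x * y) \<le> p x * p y) \<and>
     (\<forall>x. p (free_adj x * x) = (p x)\<^sup>2)"

text \<open>The universal C*-algebra on generators \<open>'g\<close> with relations \<open>r = 0\<close> for \<open>r \<in> R\<close> is the Hausdorff
  completion of the free *-algebra with respect to the largest C*-seminorm vanishing on \<open>R\<close>. (The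
  supremum has to be finite; for the CAR relations this is lemma \<open>car_seminorms_bdd\<close> below.)\<close>

definition relation_seminorms ::
  "'g free_star_algebra set \<Rightarrow> ('g free_star_algebra \<Rightarrow> real) set" where
  "relation_seminorms R = {p. cstar_seminorm p \<and> (\<forall>r\<in>R. p r = 0)}"

definition universal_seminorm :: "'g free_star_algebra set \<Rightarrow> 'g free_star_algebra \<Rightarrow> real" where
  "universal_seminorm R x = (SUP p\<in>relation_seminorms R. p x)"

definition cauchy_seqs :: "('a::ab_group_add \<Rightarrow> real) \<Rightarrow> (nat \<Rightarrow> 'a) set" where
  "cauchy_seqs p = {X. \<forall>e>0. \<exists>M. \<forall>m\<ge>M. \<forall>n\<ge>M. p (X m - X n) < e}"

definition null_rel :: "('a::ab_group_add \<Rightarrow> real) \<Rightarrow> ((nat \<Rightarrow> 'a) \<times> (nat \<Rightarrow> 'a)) set" where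
  "null_rel p = {(X, Y). X \<in> cauchy_seqs p \<and> Y \<in> cauchy_seqs p \<and> (\<lambda>n. p (X n - Y n)) \<longlonglongrightarrow> 0}"

definition cauchy_class :: "('a::ab_group_add \<Rightarrow> real) \<Rightarrow> (nat \<Rightarrow> 'a) \<Rightarrow> (nat \<Rightarrow> 'a) set" where
  "cauchy_class p X = null_rel p `` {X}"

definition completion ::
  "('g free_star_algebra \<Rightarrow> real) \<Rightarrow> (nat \<Rightarrow> 'g free_star_algebra) set cstar" where
  "completion p =
     \<lparr>carrier = cauchy_seqs p // null_rel p,
      monoid.mult = (\<lambda>C D. \<Union>X\<in>C. \<Union>Y\<in>D. cauchy_class p (\<lambda>n. X n * Y n)),
      one = cauchy_class p (\<lambda>n. 1),
      zero = cauchy_class p (\<lambda>n. 0),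
      add = (\<lambda>C D. \<Union>X\<in>C. \<Union>Y\<in>D. cauchy_class p (\<lambda>n. X n + Y n)),
      smult = (\<lambda>c C. \<Union>X\<in>C. cauchy_class p (\<lambda>n. free_scale c (X n))),
      adj = (\<lambda>C. \<Union>X\<in>C. cauchy_class p (\<lambda>n. free_adj (X n))),
      cnorm = (\<lambda>C. the_elem ((\<lambda>X. lim (\<lambda>n. p (X n))) ` C))\<rparr>"

definition universal_cstar ::
  "'g free_star_algebra set \<Rightarrow> (nat \<Rightarrow> 'g free_star_algebra) set cstar" where
  "universal_cstar R = completion (universal_seminorm R)"

definition universal_gen ::
  "'g free_star_algebra set \<Rightarrow> 'g \<Rightarrow> (nat \<Rightarrow> 'g free_star_algebra) set" where
  "universal_gen R g = cauchy_class (universal_seminorm R) (\<lambda>n. free_gen g)"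


section \<open>The self-dual CAR algebra and quasi-free states\<close>

definition car_relations ::
  "('h::chilbert_space \<Rightarrow> 'h) \<Rightarrow> 'h free_star_algebra set" where
  "car_relations \<Gamma> =
     {free_gen (\<alpha> *\<^sub>C \<xi> + \<beta> *\<^sub>C \<eta>) - (free_scale \<alpha> (free_gen \<xi>) + free_scale \<beta> (free_gen \<eta>))
       | \<alpha> \<beta> \<xi> \<eta>. True} \<union>
     {free_gen (\<Gamma> \<xi>) - free_adj (free_gen \<xi>) | \<xi>. True} \<union>
     {free_gen \<xi> * free_adj (free_gen \<eta>) + free_adj (free_gen \<eta>) * free_gen \<xi>
       - free_scale (cinner \<xi> \<eta>) 1 | \<xi> \<eta>. True}"

type_synonym 'h car = "(nat \<Rightarrow> 'h free_star_algebra) set"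

definition car_algebra :: "('h::chilbert_space \<Rightarrow> 'h) \<Rightarrow> 'h car cstar" where
  "car_algebra \<Gamma> = universal_cstar (car_relations \<Gamma>)"

definition car_gen :: "('h::chilbert_space \<Rightarrow> 'h) \<Rightarrow> 'h \<Rightarrow> 'h car" where
  "car_gen \<Gamma> \<xi> = universal_gen (car_relations \<Gamma>) \<xi>"

text \<open>The monomial \<open>b(\<xi> 1) \<cdots> b(\<xi> k)\<close>.\<close>

definition car_monomial :: "('h::chilbert_space \<Rightarrow> 'h) \<Rightarrow> (nat \<Rightarrow> 'h) \<Rightarrow> nat \<Rightarrow> 'h car" where
  "car_monomial \<Gamma> \<xi> k =
     foldr (\<lambda>i x. car_gen \<Gamma> (\<xi> i) \<otimes>\<^bsub>car_algebra \<Gamma>\<^esub> x) [1..<Suc k] \<one>\<^bsub>car_algebra \<Gamma>\<^esub>"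

definition pairings :: "nat \<Rightarrow> (nat \<Rightarrow> nat) set" where
  "pairings n = {\<sigma>. \<sigma> permutes {1..2 * n} \<and> strict_mono_on {1..n} \<sigma> \<and>
     (\<forall>i\<in>{1..n}. \<sigma> i < \<sigma> (i + n))}"

definition quasi_free :: "('h::chilbert_space \<Rightarrow> 'h) \<Rightarrow> ('h car \<Rightarrow> complex) \<Rightarrow> bool" where
  "quasi_free \<Gamma> \<phi> \<longleftrightarrow>
     state (car_algebra \<Gamma>) \<phi> \<and>
     (\<forall>k \<xi>. odd k \<longrightarrow> \<phi> (car_monomial \<Gamma> \<xi> k) = 0) \<and>
     (\<forall>n \<xi>. \<phi> (car_monomial \<Gamma> \<xi> (2 * n)) =
        (-1) ^ ((n - 1) * n div 2) *
        (\<Sum>\<sigma>\<in>pairings n. of_int (sign \<sigma>) *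
          (\<Prod>i=1..n. \<phi> (car_gen \<Gamma> (\<xi> (\<sigma> i)) \<otimes>\<^bsub>car_algebra \<Gamma>\<^esub> car_gen \<Gamma> (\<xi> (\<sigma> (i + n)))))))"

text \<open>For a covariance operator \<open>S\<close> there is exactly one such state.\<close>

definition quasi_free_state ::
  "('h::chilbert_space \<Rightarrow> 'h) \<Rightarrow> ('h \<Rightarrow> 'h) \<Rightarrow> 'h car \<Rightarrow> complex" where
  "quasi_free_state \<Gamma> S = (THE \<phi>. quasi_free \<Gamma> \<phi> \<and>
     (\<forall>\<xi> \<eta>. cinner (S \<xi>) \<eta> =
        \<phi> (adj (car_algebra \<Gamma>) (car_gen \<Gamma> \<eta>) \<otimes>\<^bsub>car_algebra \<Gamma>\<^esub> car_gen \<Gamma> \<xi>)))"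

definition affine_property ::
  "('h::chilbert_space \<Rightarrow> 'h) \<Rightarrow> ('h \<Rightarrow> 'h) \<Rightarrow> ('h \<Rightarrow> 'h) \<Rightarrow> bool" where
  "affine_property \<Gamma> S S' \<longleftrightarrow>
     (\<forall>t\<in>{0..1}. \<forall>x\<in>carrier (car_algebra \<Gamma>).
        quasi_free_state \<Gamma> (\<lambda>\<xi>. t *\<^sub>R S \<xi> + (1 - t) *\<^sub>R S' \<xi>) x =
        of_real t * quasi_free_state \<Gamma> S x + of_real (1 - t) * quasi_free_state \<Gamma> S' x)"


section \<open>The CAR algebra is a C*-algebra satisfying the CAR relations\<close>

lemma word_adj_word_adj [simp]: "word_adj (word_adj w) = w"
  by (cases w) (simp add: word_adj_def rev_map o_def case_prod_unfold)

lemma word_adj_add: "word_adj (u + v) = word_adj v + word_adj u"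
  by (simp add: word_adj_def plus_star_word_def)

lemma word_adj_0 [simp]: "word_adj 0 = 0"
  by (simp add: word_adj_def zero_star_word_def)

lemma inj_word_adj: "inj word_adj"
  by (metis injI word_adj_word_adj)

lemma lookup_free_scale: "Poly_Mapping.lookup (free_scale c x) w = c * Poly_Mapping.lookup x w"
  by (simp add: free_scale_def map.rep_eq when_def)

lemma lookup_free_adj: "Poly_Mapping.lookup (free_adj x) w = cnj (Poly_Mapping.lookup x (word_adj w))"
proof -
  have "Poly_Mapping.lookup (Poly_Mapping.map cnj x) u = cnj (Poly_Mapping.lookup x u)" for u
    by (simp add: map.rep_eq when_def)
  moreover have "Poly_Mapping.lookup (Poly_Mapping.map_key word_adj y) u = Poly_Mapping.lookup y (word_adj u)"
    for y :: "'a free_star_algebra" and u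
    by (simp add: map_key.rep_eq[OF inj_word_adj])
  ultimately show ?thesis by (simp add: free_adj_def)
qed

lemma free_scale_conv_mult: "free_scale c x = Poly_Mapping.single 0 c * x"
  by (simp add: free_scale_def mult_map_scale_conv_mult)

lemma free_induct [case_names zero single add]:
  fixes x :: "'g free_star_algebra"
  assumes "P 0" "\<And>w c. P (Poly_Mapping.single w c)" "\<And>x y. P x \<Longrightarrow> P y \<Longrightarrow> P (x + y)"
  shows "P x"
proof (induction x rule: update_induct)
  case const
  then show ?case by (rule assms(1))
next
  case (update x w c)
  have "Poly_Mapping.update w c x = x + Poly_Mapping.single w c"
    using update.hyps
    by (intro poly_mapping_eqI) (auto simp: lookup_update lookup_add lookup_single when_def in_keys_iff)
  then show ?case using update assms by metis
qed

lemma free_scale_mult_left: "free_scale c x * y = free_scale c (x * y)"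
  by (simp add: free_scale_conv_mult mult.assoc)

lemma single_0_commute: "x * Poly_Mapping.single 0 c = Poly_Mapping.single 0 c * (x :: 'g free_star_algebra)"
  by (induction x rule: free_induct) (simp_all add: mult_single algebra_simps)

lemma free_scale_mult_right: "x * free_scale c y = free_scale c (x * y)"
  by (metis free_scale_conv_mult mult.assoc single_0_commute)

lemma free_scale_simps:
  "free_scale c (x + y) = free_scale c x + free_scale c y"
  "free_scale (c + d) x = free_scale c x + free_scale d x"
  "free_scale c (free_scale d x) = free_scale (c * d) x"
  "free_scale 1 x = x"
  "free_scale 0 x = 0"
  "free_scale c (x - y) = free_scale c x - free_scale c y"
  "free_scale (-1) x = - x"
  by (auto intro!: poly_mapping_eqI simp: lookup_free_scale lookup_add lookup_minus algebra_simps)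

lemma free_adj_add: "free_adj (x + y) = free_adj x + free_adj y"
  by (auto intro!: poly_mapping_eqI simp: lookup_free_adj lookup_add)

lemma free_adj_diff: "free_adj (x - y) = free_adj x - free_adj y"
  by (auto intro!: poly_mapping_eqI simp: lookup_free_adj lookup_minus)

lemma free_adj_0 [simp]: "free_adj 0 = 0"
  by (auto intro!: poly_mapping_eqI simp: lookup_free_adj)

lemma free_adj_free_adj [simp]: "free_adj (free_adj x) = x"
  by (auto intro!: poly_mapping_eqI simp: lookup_free_adj)

lemma free_adj_scale: "free_adj (free_scale c x) = free_scale (cnj c) (free_adj x)"
  by (auto intro!: poly_mapping_eqI simp: lookup_free_adj lookup_free_scale)

lemma free_adj_single:
  "free_adj (Poly_Mapping.single w c) = Poly_Mapping.single (word_adj w) (cnj c)"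
proof (rule poly_mapping_eqI)
  fix u
  have "w = word_adj u \<longleftrightarrow> word_adj w = u" by auto
  then show "Poly_Mapping.lookup (free_adj (Poly_Mapping.single w c)) u =
      Poly_Mapping.lookup (Poly_Mapping.single (word_adj w) (cnj c)) u"
    by (cases "word_adj w = u") (simp_all add: lookup_free_adj lookup_single)
qed

lemma free_adj_mult: "free_adj (x * y) = free_adj y * free_adj (x :: 'g free_star_algebra)"
proof (induction x rule: free_induct)
  case (single w c)
  show ?case
    by (induction y rule: free_induct)
      (simp_all add: mult_single free_adj_single word_adj_add free_adj_add algebra_simps)
qed (simp_all add: free_adj_add algebra_simps)

lemma free_adj_1 [simp]: "free_adj 1 = 1"
  using free_adj_single[of 0 1] by simp


locale seminormed_star_algebra =
  fixes p :: "'g free_star_algebra \<Rightarrow> real"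
  assumes cstar_seminorm: "cstar_seminorm p"
begin

lemma p_add: "p (x + y) \<le> p x + p y"
  and p_scale: "p (free_scale c x) = cmod c * p x"
  and p_mult: "p (x * y) \<le> p x * p y"
  and p_cstar: "p (free_adj x * x) = (p x)\<^sup>2"
  using cstar_seminorm by (auto simp: cstar_seminorm_def)

lemma p_0 [simp]: "p 0 = 0"
  using p_scale[of 0 0] by (simp add: free_scale_simps)

lemma p_minus: "p (- x) = p x"
  using p_scale[of "-1" x] by (simp add: free_scale_simps)

lemma p_nonneg [simp]: "0 \<le> p x"
  using p_add[of x "-x"] by (simp add: p_minus)

lemma p_commute: "p (x - y) = p (y - x)"
  using p_minus[of "x - y"] by simp

lemma p_triangle: "p (x - z) \<le> p (x - y) + p (y - z)"
  using p_add[of "x - y" "y - z"] by simp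

lemma p_diff_le: "\<bar>p x - p y\<bar> \<le> p (x - y)"
  using p_add[of "x - y" y] p_add[of "y - x" x] p_commute[of x y] by simp

lemma p_adj: "p (free_adj x) = p x"
proof -
  have *: "p x \<le> p (free_adj x)" for x
  proof (cases "p x = 0")
    case False
    have "p x * p x \<le> p (free_adj x) * p x"
      using p_mult[of "free_adj x" x] p_cstar[of x] by (simp add: power2_eq_square)
    then show ?thesis using False p_nonneg[of x] by (simp add: mult_le_cancel_right)
  qed simp
  show ?thesis using *[of x] *[of "free_adj x"] by simp
qed

lemma p_mult_diff: "p (x * y - x' * y') \<le> p x * p (y - y') + p (x - x') * p y'"
proof -
  have "x * y - x' * y' = x * (y - y') + (x - x') * y'" by (simp add: algebra_simps)
  then show ?thesis using p_add p_mult by (smt (verit))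
qed

lemma cauchyI_bound:
  assumes X: "X \<in> cauchy_seqs p" and Y: "\<And>m n. p (Y m - Y n) \<le> c * p (X m - X n)"
  shows "Y \<in> cauchy_seqs p"
  unfolding cauchy_seqs_def
proof (intro CollectI allI impI)
  fix e :: real assume "e > 0"
  let ?c = "max c 1"
  have "e / ?c > 0" using \<open>e > 0\<close> by simp
  then obtain M where M: "\<And>m n. m \<ge> M \<Longrightarrow> n \<ge> M \<Longrightarrow> p (X m - X n) < e / ?c"
    using X unfolding cauchy_seqs_def by blast
  have "p (Y m - Y n) < e" if "m \<ge> M" "n \<ge> M" for m n
  proof -
    have "p (Y m - Y n) \<le> ?c * p (X m - X n)"
      using Y[of m n] mult_right_mono[of c ?c "p (X m - X n)"] by simp
    also have "\<dots> < e" using M[OF that] by (simp add: field_simps)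
    finally show ?thesis .
  qed
  then show "\<exists>M. \<forall>m\<ge>M. \<forall>n\<ge>M. p (Y m - Y n) < e" by blast
qed

lemma cauchyD:
  assumes "X \<in> cauchy_seqs p" "e > 0"
  obtains M where "\<And>m n. m \<ge> M \<Longrightarrow> n \<ge> M \<Longrightarrow> p (X m - X n) < e"
  using assms unfolding cauchy_seqs_def by blast

lemma cauchy_const [simp]: "(\<lambda>n. x) \<in> cauchy_seqs p"
  by (simp add: cauchy_seqs_def)

lemma cauchy_add:
  assumes "X \<in> cauchy_seqs p" "Y \<in> cauchy_seqs p"
  shows "(\<lambda>n. X n + Y n) \<in> cauchy_seqs p"
  unfolding cauchy_seqs_def
proof (intro CollectI allI impI)
  fix e :: real assume "e > 0"
  obtain M where M: "\<And>m n. m \<ge> M \<Longrightarrow> n \<ge> M \<Longrightarrow> p (X m - X n) < e / 2"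
    using cauchyD[OF assms(1), of "e / 2"] \<open>e > 0\<close> by auto
  obtain N where N: "\<And>m n. m \<ge> N \<Longrightarrow> n \<ge> N \<Longrightarrow> p (Y m - Y n) < e / 2"
    using cauchyD[OF assms(2), of "e / 2"] \<open>e > 0\<close> by auto
  have "p (X m + Y m - (X n + Y n)) < e" if "m \<ge> max M N" "n \<ge> max M N" for m n
    using M[of m n] N[of m n] p_add[of "X m - X n" "Y m - Y n"] that
    by (simp add: algebra_simps)
  then show "\<exists>M. \<forall>m\<ge>M. \<forall>n\<ge>M. p (X m + Y m - (X n + Y n)) < e" by blast
qed

lemma cauchy_scale: "X \<in> cauchy_seqs p \<Longrightarrow> (\<lambda>n. free_scale c (X n)) \<in> cauchy_seqs p"
proof (erule cauchyI_bound)
  show "p (free_scale c (X m) - free_scale c (X n)) \<le> cmod c * p (X m - X n)" for m n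
    unfolding free_scale_simps(6)[symmetric] p_scale by (rule order_refl)
qed

lemma cauchy_adj: "X \<in> cauchy_seqs p \<Longrightarrow> (\<lambda>n. free_adj (X n)) \<in> cauchy_seqs p"
proof (erule cauchyI_bound)
  show "p (free_adj (X m) - free_adj (X n)) \<le> 1 * p (X m - X n)" for m n
    unfolding free_adj_diff[symmetric] p_adj by simp
qed

lemma cauchy_Cauchy: "X \<in> cauchy_seqs p \<Longrightarrow> Cauchy (\<lambda>n. p (X n))"
  unfolding Cauchy_def dist_real_def
proof (intro allI impI)
  fix e :: real assume "X \<in> cauchy_seqs p" "e > 0"
  then obtain M where "\<And>m n. m \<ge> M \<Longrightarrow> n \<ge> M \<Longrightarrow> p (X m - X n) < e" using cauchyD by blast
  then show "\<exists>M. \<forall>m\<ge>M. \<forall>n\<ge>M. \<bar>p (X m) - p (X n)\<bar> < e"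
    using p_diff_le le_less_trans by blast
qed

lemma cauchy_norm_convergent: "X \<in> cauchy_seqs p \<Longrightarrow> (\<lambda>n. p (X n)) \<longlonglongrightarrow> lim (\<lambda>n. p (X n))"
  using cauchy_Cauchy Cauchy_convergent convergent_LIMSEQ_iff by blast

lemma cauchy_bounded:
  assumes "X \<in> cauchy_seqs p"
  obtains B where "B > 0" "\<And>n. p (X n) \<le> B"
proof -
  have "Bseq (\<lambda>n. p (X n))" using cauchy_Cauchy[OF assms] Cauchy_Bseq by blast
  then show ?thesis using that by (auto simp: Bseq_def)
qed

lemma cauchy_mult:
  assumes X: "X \<in> cauchy_seqs p" and Y: "Y \<in> cauchy_seqs p"
  shows "(\<lambda>n. X n * Y n) \<in> cauchy_seqs p"
  unfolding cauchy_seqs_def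
proof (intro CollectI allI impI)
  fix e :: real assume "e > 0"
  obtain B where B: "B > 0" "\<And>n. p (X n) \<le> B" using cauchy_bounded[OF X] by blast
  obtain C where C: "C > 0" "\<And>n. p (Y n) \<le> C" using cauchy_bounded[OF Y] by blast
  have "e / (2 * C) > 0" "e / (2 * B) > 0" using \<open>e > 0\<close> B C by auto
  then obtain M N where M: "\<And>m n. m \<ge> M \<Longrightarrow> n \<ge> M \<Longrightarrow> p (X m - X n) < e / (2 * C)"
    and N: "\<And>m n. m \<ge> N \<Longrightarrow> n \<ge> N \<Longrightarrow> p (Y m - Y n) < e / (2 * B)"
    using cauchyD[OF X] cauchyD[OF Y] by metis
  have "p (X m * Y m - X n * Y n) < e" if "m \<ge> max M N" "n \<ge> max M N" for m n
  proof -
    have "p (X m * Y m - X n * Y n) \<le> p (X m) * p (Y m - Y n) + p (X m - X n) * p (Y n)"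
      by (rule p_mult_diff)
    also have "\<dots> \<le> B * p (Y m - Y n) + p (X m - X n) * C"
      using B C by (intro add_mono mult_right_mono mult_left_mono) auto
    also have "\<dots> < B * (e / (2 * B)) + (e / (2 * C)) * C"
      using M[of m n] N[of m n] that B C
      by (intro add_strict_mono mult_strict_left_mono mult_strict_right_mono) auto
    also have "\<dots> = e" using B C by simp
    finally show ?thesis .
  qed
  then show "\<exists>M. \<forall>m\<ge>M. \<forall>n\<ge>M. p (X m * Y m - X n * Y n) < e" by blast
qed

lemma null_squeeze:
  assumes "g \<longlonglongrightarrow> 0" "\<And>n. p (f n) \<le> g n"
  shows "(\<lambda>n. p (f n)) \<longlonglongrightarrow> 0"
  by (rule tendsto_sandwich[OF _ _ tendsto_const assms(1)]) (simp_all add: assms(2))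

lemma equiv_null_rel: "equiv (cauchy_seqs p) (null_rel p)"
proof (rule equivI)
  show "null_rel p \<subseteq> cauchy_seqs p \<times> cauchy_seqs p" by (auto simp: null_rel_def)
  show "refl_on (cauchy_seqs p) (null_rel p)" by (auto simp: refl_on_def null_rel_def)
  show "sym (null_rel p)"
  proof (rule symI)
    fix X Y assume "(X, Y) \<in> null_rel p"
    then show "(Y, X) \<in> null_rel p"
      unfolding null_rel_def using p_commute[of "X _" "Y _"] by simp
  qed
  show "trans (null_rel p)"
  proof (rule transI)
    fix X Y Z assume *: "(X, Y) \<in> null_rel p" "(Y, Z) \<in> null_rel p"
    have "(\<lambda>n. p (X n - Y n) + p (Y n - Z n)) \<longlonglongrightarrow> 0 + 0"
      using * by (intro tendsto_add) (auto simp: null_rel_def)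
    then have "(\<lambda>n. p (X n - Y n) + p (Y n - Z n)) \<longlonglongrightarrow> 0" by simp
    then have "(\<lambda>n. p (X n - Z n)) \<longlonglongrightarrow> 0" by (rule null_squeeze) (rule p_triangle)
    then show "(X, Z) \<in> null_rel p" using * by (auto simp: null_rel_def)
  qed
qed

abbreviation "cls \<equiv> cauchy_class p"

lemma cls_closed: "X \<in> cauchy_seqs p \<Longrightarrow> cls X \<in> carrier (completion p)"
  by (simp add: completion_def cauchy_class_def quotientI)

lemma carrierE:
  assumes "C \<in> carrier (completion p)"
  obtains X where "X \<in> cauchy_seqs p" "C = cls X"
  using assms by (auto simp: completion_def cauchy_class_def elim: quotientE)

lemma cls_eq_iff:
  assumes "X \<in> cauchy_seqs p" "Y \<in> cauchy_seqs p"
  shows "cls X = cls Y \<longleftrightarrow> (\<lambda>n. p (X n - Y n)) \<longlonglongrightarrow> 0"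
  using eq_equiv_class_iff[OF equiv_null_rel assms] assms
  by (simp add: cauchy_class_def null_rel_def)

lemma null_relD: "(X, Y) \<in> null_rel p \<Longrightarrow>
    X \<in> cauchy_seqs p \<and> Y \<in> cauchy_seqs p \<and> (\<lambda>n. p (X n - Y n)) \<longlonglongrightarrow> 0"
  by (simp add: null_rel_def)

lemma lift1:
  assumes X: "X \<in> cauchy_seqs p"
    and f: "\<And>Y. Y \<in> cauchy_seqs p \<Longrightarrow> (\<lambda>n. f (Y n)) \<in> cauchy_seqs p"
    and b: "\<And>x y. p (f x - f y) \<le> c * p (x - y)"
  shows "(\<Union>Y\<in>cls X. cls (\<lambda>n. f (Y n))) = cls (\<lambda>n. f (X n))"
  unfolding cauchy_class_def[of p X]
proof (rule UN_equiv_class[OF equiv_null_rel _ X])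
  show "(\<lambda>Y. cls (\<lambda>n. f (Y n))) respects null_rel p"
  proof (rule congruentI)
    fix Y Z assume "(Y, Z) \<in> null_rel p"
    then have *: "Y \<in> cauchy_seqs p" "Z \<in> cauchy_seqs p" "(\<lambda>n. p (Y n - Z n)) \<longlonglongrightarrow> 0"
      using null_relD by auto
    have "(\<lambda>n. c * p (Y n - Z n)) \<longlonglongrightarrow> c * 0" by (intro tendsto_mult tendsto_const *)
    then have "(\<lambda>n. c * p (Y n - Z n)) \<longlonglongrightarrow> 0" by simp
    then have "(\<lambda>n. p (f (Y n) - f (Z n))) \<longlonglongrightarrow> 0" by (rule null_squeeze) (rule b)
    then show "cls (\<lambda>n. f (Y n)) = cls (\<lambda>n. f (Z n))" using * f by (simp add: cls_eq_iff)
  qed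
qed

lemma add_cls:
  assumes X: "X \<in> cauchy_seqs p" and Y: "Y \<in> cauchy_seqs p"
  shows "cls X \<oplus>\<^bsub>completion p\<^esub> cls Y = cls (\<lambda>n. X n + Y n)"
proof -
  have "(\<lambda>X Y. cls (\<lambda>n. X n + Y n)) respects2 null_rel p"
  proof (rule congruent2I')
    fix X X' Y Y' assume "(X, X') \<in> null_rel p" "(Y, Y') \<in> null_rel p"
    then have *: "X \<in> cauchy_seqs p" "X' \<in> cauchy_seqs p" "(\<lambda>n. p (X n - X' n)) \<longlonglongrightarrow> 0"
      "Y \<in> cauchy_seqs p" "Y' \<in> cauchy_seqs p" "(\<lambda>n. p (Y n - Y' n)) \<longlonglongrightarrow> 0"
      using null_relD by auto
    have "(\<lambda>n. p (X n - X' n) + p (Y n - Y' n)) \<longlonglongrightarrow> 0 + 0" by (intro tendsto_add *)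
    then have "(\<lambda>n. p (X n - X' n) + p (Y n - Y' n)) \<longlonglongrightarrow> 0" by simp
    moreover have "p (X n + Y n - (X' n + Y' n)) \<le> p (X n - X' n) + p (Y n - Y' n)" for n
      using p_add[of "X n - X' n" "Y n - Y' n"] by (simp add: algebra_simps)
    ultimately have "(\<lambda>n. p (X n + Y n - (X' n + Y' n))) \<longlonglongrightarrow> 0"
      by (rule null_squeeze)
    then show "cls (\<lambda>n. X n + Y n) = cls (\<lambda>n. X' n + Y' n)"
      using * by (simp add: cls_eq_iff cauchy_add)
  qed
  from UN_equiv_class2[OF equiv_null_rel equiv_null_rel this X Y]
  show ?thesis by (simp add: completion_def cauchy_class_def)
qed

lemma mult_cls:
  assumes X: "X \<in> cauchy_seqs p" and Y: "Y \<in> cauchy_seqs p"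
  shows "cls X \<otimes>\<^bsub>completion p\<^esub> cls Y = cls (\<lambda>n. X n * Y n)"
proof -
  have "(\<lambda>X Y. cls (\<lambda>n. X n * Y n)) respects2 null_rel p"
  proof (rule congruent2I')
    fix X X' Y Y' assume "(X, X') \<in> null_rel p" "(Y, Y') \<in> null_rel p"
    then have *: "X \<in> cauchy_seqs p" "X' \<in> cauchy_seqs p" "(\<lambda>n. p (X n - X' n)) \<longlonglongrightarrow> 0"
      "Y \<in> cauchy_seqs p" "Y' \<in> cauchy_seqs p" "(\<lambda>n. p (Y n - Y' n)) \<longlonglongrightarrow> 0"
      using null_relD by auto
    have "(\<lambda>n. p (X n) * p (Y n - Y' n) + p (X n - X' n) * p (Y' n)) \<longlonglongrightarrow>
        lim (\<lambda>n. p (X n)) * 0 + 0 * lim (\<lambda>n. p (Y' n))"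
      by (intro tendsto_add tendsto_mult * cauchy_norm_convergent)
    then have "(\<lambda>n. p (X n) * p (Y n - Y' n) + p (X n - X' n) * p (Y' n)) \<longlonglongrightarrow> 0" by simp
    then have "(\<lambda>n. p (X n * Y n - X' n * Y' n)) \<longlonglongrightarrow> 0"
      by (rule null_squeeze) (rule p_mult_diff)
    then show "cls (\<lambda>n. X n * Y n) = cls (\<lambda>n. X' n * Y' n)"
      using * by (simp add: cls_eq_iff cauchy_mult)
  qed
  from UN_equiv_class2[OF equiv_null_rel equiv_null_rel this X Y]
  show ?thesis by (simp add: completion_def cauchy_class_def)
qed

lemma smult_cls:
  assumes "X \<in> cauchy_seqs p"
  shows "c \<odot>\<^bsub>completion p\<^esub> cls X = cls (\<lambda>n. free_scale c (X n))"
proof -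
  have "p (free_scale c x - free_scale c y) \<le> cmod c * p (x - y)" for x y
    unfolding free_scale_simps(6)[symmetric] p_scale by (rule order_refl)
  from lift1[OF assms cauchy_scale this] show ?thesis by (simp add: completion_def)
qed

lemma adj_cls:
  assumes "X \<in> cauchy_seqs p"
  shows "adj (completion p) (cls X) = cls (\<lambda>n. free_adj (X n))"
proof -
  have "p (free_adj x - free_adj y) \<le> 1 * p (x - y)" for x y
    unfolding free_adj_diff[symmetric] p_adj by simp
  from lift1[OF assms cauchy_adj this] show ?thesis by (simp add: completion_def)
qed

lemma one_cls: "\<one>\<^bsub>completion p\<^esub> = cls (\<lambda>n. 1)"
  and zero_cls: "\<zero>\<^bsub>completion p\<^esub> = cls (\<lambda>n. 0)"
  by (simp_all add: completion_def)

lemma cnorm_cls: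
  assumes X: "X \<in> cauchy_seqs p"
  shows "cnorm (completion p) (cls X) = lim (\<lambda>n. p (X n))"
proof -
  have "lim (\<lambda>n. p (Y n)) = lim (\<lambda>n. p (X n))" if "Y \<in> cls X" for Y
  proof -
    have *: "Y \<in> cauchy_seqs p" "(\<lambda>n. p (X n - Y n)) \<longlonglongrightarrow> 0"
      using that null_relD by (auto simp: cauchy_class_def)
    have "(\<lambda>n. p (X n) - p (Y n)) \<longlonglongrightarrow> 0"
      by (rule Lim_null_comparison[OF _ *(2)]) (auto simp: p_diff_le)
    from tendsto_diff[OF cauchy_norm_convergent[OF X] this]
    have "(\<lambda>n. p (Y n)) \<longlonglongrightarrow> lim (\<lambda>n. p (X n))" by simp
    then show ?thesis by (rule limI)
  qed
  moreover have "X \<in> cls X" using X by (auto simp: cauchy_class_def null_rel_def)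
  ultimately have "(\<lambda>X. lim (\<lambda>n. p (X n))) ` cls X = {lim (\<lambda>n. p (X n))}" by blast
  then show ?thesis by (simp add: completion_def)
qed

lemma cnorm_cls_limit:
  "X \<in> cauchy_seqs p \<Longrightarrow> (\<lambda>n. p (X n)) \<longlonglongrightarrow> cnorm (completion p) (cls X)"
  by (simp add: cnorm_cls cauchy_norm_convergent)

lemmas cls_ops = add_cls mult_cls smult_cls adj_cls one_cls zero_cls
lemmas cauchy_ops = cauchy_add cauchy_mult cauchy_scale cauchy_adj cauchy_const

lemma ring_completion: "ring (completion p)"
proof (rule ringI)
  show "abelian_group (completion p)"
  proof (rule abelian_groupI)
    fix C assume "C \<in> carrier (completion p)"
    then obtain X where X: "X \<in> cauchy_seqs p" "C = cls X" by (rule carrierE)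
    have "(\<lambda>n. free_scale (-1) (X n)) \<in> cauchy_seqs p" using X by (simp add: cauchy_ops)
    moreover have "cls (\<lambda>n. free_scale (-1) (X n)) \<oplus>\<^bsub>completion p\<^esub> C = \<zero>\<^bsub>completion p\<^esub>"
      using X by (simp add: cls_ops cauchy_scale free_scale_simps)
         (use X cauchy_scale[of X "-1"] in \<open>simp add: free_scale_simps cls_ops\<close>)
    ultimately show "\<exists>D\<in>carrier (completion p). D \<oplus>\<^bsub>completion p\<^esub> C = \<zero>\<^bsub>completion p\<^esub>"
      using cls_closed by blast
  qed (auto elim!: carrierE simp: cls_ops cauchy_ops cls_closed algebra_simps)
  show "Group.monoid (completion p)"
    by (rule monoidI) (auto elim!: carrierE simp: cls_ops cauchy_ops cls_closed mult.assoc)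
qed (auto elim!: carrierE simp: cls_ops cauchy_ops cls_closed algebra_simps)

lemma minus_cls:
  assumes X: "X \<in> cauchy_seqs p" and Y: "Y \<in> cauchy_seqs p"
  shows "cls X \<ominus>\<^bsub>completion p\<^esub> cls Y = cls (\<lambda>n. X n - Y n)" "(\<lambda>n. X n - Y n) \<in> cauchy_seqs p"
proof -
  interpret ring "completion p" by (rule ring_completion)
  have mY: "(\<lambda>n. - Y n) \<in> cauchy_seqs p"
    using cauchy_scale[OF Y, of "-1"] by (simp add: free_scale_simps)
  have "\<ominus>\<^bsub>completion p\<^esub> cls Y = cls (\<lambda>n. - Y n)"
    by (rule minus_equality) (use Y mY in \<open>simp_all add: cls_ops cls_closed\<close>)
  then show "cls X \<ominus>\<^bsub>completion p\<^esub> cls Y = cls (\<lambda>n. X n - Y n)" "(\<lambda>n. X n - Y n) \<in> cauchy_seqs p"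
    using X mY cauchy_add[OF X mY] by (simp_all add: a_minus_def cls_ops)
qed

lemma complete_aux:
  assumes C: "\<And>k. C k \<in> carrier (completion p)"
    and Cauchy: "\<forall>e>0. \<exists>M. \<forall>k\<ge>M. \<forall>l\<ge>M. cnorm (completion p) (C k \<ominus>\<^bsub>completion p\<^esub> C l) < e"
  shows "\<exists>D\<in>carrier (completion p).
    (\<lambda>k::nat. cnorm (completion p) (C k \<ominus>\<^bsub>completion p\<^esub> D)) \<longlonglongrightarrow> 0"
proof -
  have "\<exists>X. X \<in> cauchy_seqs p \<and> C k = cls X" for k using C[of k] carrierE by metis
  then obtain X where X: "\<And>k. X k \<in> cauchy_seqs p" "\<And>k. C k = cls (X k)" by metis
  have "\<exists>M. \<forall>m\<ge>M. \<forall>n\<ge>M. p (X k m - X k n) < 1 / Suc k" for k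
    using X(1)[of k] unfolding cauchy_seqs_def by auto
  then obtain N where N: "\<And>k m n. m \<ge> N k \<Longrightarrow> n \<ge> N k \<Longrightarrow> p (X k m - X k n) < 1 / Suc k"
    by metis
  define y where "y k = X k (N k)" for k
  have lim_le: "cnorm (completion p) (cls Z) \<le> B"
    if "Z \<in> cauchy_seqs p" "\<And>n. n \<ge> M \<Longrightarrow> p (Z n) \<le> B" for Z B M
    using that by (intro LIMSEQ_le_const2[OF cnorm_cls_limit]) auto
  have yC: "p (y k - X k n) \<le> 1 / Suc k" if "n \<ge> N k" for k n
    using N[of k "N k" n] that by (simp add: y_def)
  have y: "y \<in> cauchy_seqs p"
    unfolding cauchy_seqs_def
  proof (intro CollectI allI impI)
    fix e :: real assume "e > 0"
    then have e3: "e / 4 > 0" by simp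
    obtain M where M: "\<And>k l. k \<ge> M \<Longrightarrow> l \<ge> M \<Longrightarrow> cnorm (completion p) (C k \<ominus>\<^bsub>completion p\<^esub> C l) < e / 4"
      using Cauchy e3 by blast
    obtain K where K: "1 / Suc K < e / 4" using e3 nat_approx_posE by blast
    have "p (y k - y l) < e" if kl: "k \<ge> max M K" "l \<ge> max M K" for k l
    proof -
      have "cnorm (completion p) (cls (\<lambda>n. X k n - X l n)) < e / 4"
        using M[of k l] kl by (simp add: X minus_cls)
      then have "\<forall>\<^sub>F n in sequentially. p (X k n - X l n) < e / 4"
        using cnorm_cls_limit[OF minus_cls(2)[OF X(1) X(1)]] order_tendstoD(2) by blast
      then obtain n0 where n0: "\<And>n. n \<ge> n0 \<Longrightarrow> p (X k n - X l n) < e / 4"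
        by (auto simp: eventually_sequentially)
      define n where "n = Max {n0, N k, N l}"
      have n: "n \<ge> n0" "n \<ge> N k" "n \<ge> N l" by (auto simp: n_def)
      have s: "1 / real (Suc k) \<le> 1 / Suc K" "1 / real (Suc l) \<le> 1 / Suc K"
        using kl by (auto intro!: divide_left_mono)
      have "p (y k - y l) \<le> p (y k - X k n) + (p (X k n - X l n) + p (X l n - y l))"
        using p_triangle[of "y k" "y l" "X k n"] p_triangle[of "X k n" "y l" "X l n"] by linarith
      moreover have "p (y k - X k n) < e / 4" using yC[OF n(2)] s K by linarith
      moreover have "p (X l n - y l) < e / 4" using yC[OF n(3)] s K p_commute[of "y l" "X l n"] by linarith
      ultimately show ?thesis using n0[OF n(1)] \<open>e > 0\<close> by linarith
    qed
    then show "\<exists>M. \<forall>m\<ge>M. \<forall>n\<ge>M. p (y m - y n) < e" by blast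
  qed
  have "(\<lambda>k. cnorm (completion p) (C k \<ominus>\<^bsub>completion p\<^esub> cls y)) \<longlonglongrightarrow> 0"
  proof (rule LIMSEQ_I)
    fix e :: real assume "e > 0"
    then have e3: "e / 4 > 0" by simp
    obtain M where M: "\<And>k l. k \<ge> M \<Longrightarrow> l \<ge> M \<Longrightarrow> p (y k - y l) < e / 4"
      using y e3 unfolding cauchy_seqs_def by blast
    obtain K where K: "1 / Suc K < e / 4" using e3 nat_approx_posE by blast
    have "norm (cnorm (completion p) (C k \<ominus>\<^bsub>completion p\<^esub> cls y) - 0) < e" if k: "k \<ge> max M K" for k
    proof -
      have *: "C k \<ominus>\<^bsub>completion p\<^esub> cls y = cls (\<lambda>n. X k n - y n)" "(\<lambda>n. X k n - y n) \<in> cauchy_seqs p"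
        using minus_cls[OF X(1) y] X(2) by auto
      have s: "1 / real (Suc k) \<le> 1 / Suc K" using k by (auto intro!: divide_left_mono)
      have "p (X k n - y n) \<le> e / 2" if n: "n \<ge> max M (N k)" for n
        using yC[of k n] M[of k n] p_triangle[of "X k n" "y n" "y k"] p_commute[of "y k" "X k n"] s K n k
        by fastforce
      then have "cnorm (completion p) (cls (\<lambda>n. X k n - y n)) \<le> e / 2"
        using lim_le[OF *(2)] by blast
      moreover have "cnorm (completion p) (cls (\<lambda>n. X k n - y n)) \<ge> 0"
        by (rule LIMSEQ_le_const[OF cnorm_cls_limit[OF *(2)]]) auto
      ultimately show ?thesis using * \<open>e > 0\<close> by simp
    qed
    then show "\<exists>no. \<forall>n\<ge>no. norm (cnorm (completion p) (C n \<ominus>\<^bsub>completion p\<^esub> cls y) - 0) < e" by blast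
  qed
  then show ?thesis using cls_closed[OF y] by blast
qed

theorem cstar_algebra_completion: "cstar_algebra (completion p)"
proof (intro cstar_algebra.intro ring_completion cstar_algebra_axioms.intro)
  let ?A = "completion p"
  show "cnorm ?A C = 0 \<longleftrightarrow> C = \<zero>\<^bsub>?A\<^esub>" if C: "C \<in> carrier ?A" for C
    using C
  proof (rule carrierE)
    fix X assume X: "X \<in> cauchy_seqs p" "C = cls X"
    show ?thesis
      using cls_eq_iff[OF X(1) cauchy_const[of 0]] cnorm_cls_limit[OF X(1)] X(2)
        LIMSEQ_unique by (auto simp: zero_cls)
  qed
  show "cnorm ?A (C \<oplus>\<^bsub>?A\<^esub> D) \<le> cnorm ?A C + cnorm ?A D"
    if "C \<in> carrier ?A" "D \<in> carrier ?A" for C D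
    using that
    by (elim carrierE) (auto simp: cls_ops p_add intro!: LIMSEQ_le[OF cnorm_cls_limit]
        tendsto_add cnorm_cls_limit cauchy_ops)
  show "cnorm ?A (C \<otimes>\<^bsub>?A\<^esub> D) \<le> cnorm ?A C * cnorm ?A D"
    if "C \<in> carrier ?A" "D \<in> carrier ?A" for C D
    using that
    by (elim carrierE) (auto simp: cls_ops p_mult intro!: LIMSEQ_le[OF cnorm_cls_limit]
        tendsto_mult cnorm_cls_limit cauchy_ops)
  show "cnorm ?A (c \<odot>\<^bsub>?A\<^esub> C) = cmod c * cnorm ?A C" if "C \<in> carrier ?A" for c C
    using that
  proof (rule carrierE)
    fix X assume X: "X \<in> cauchy_seqs p" "C = cls X"
    have "(\<lambda>n. p (free_scale c (X n))) \<longlonglongrightarrow> cmod c * cnorm ?A (cls X)"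
      unfolding p_scale by (intro tendsto_mult tendsto_const cnorm_cls_limit X)
    then show ?thesis using X cnorm_cls_limit[OF cauchy_scale[OF X(1), of c]] LIMSEQ_unique
      by (auto simp: cls_ops)
  qed
  show "cnorm ?A (adj ?A C \<otimes>\<^bsub>?A\<^esub> C) = (cnorm ?A C)\<^sup>2" if "C \<in> carrier ?A" for C
    using that
  proof (rule carrierE)
    fix X assume X: "X \<in> cauchy_seqs p" "C = cls X"
    have "(\<lambda>n. p (free_adj (X n) * X n)) \<longlonglongrightarrow> (cnorm ?A (cls X))\<^sup>2"
      unfolding p_cstar by (intro tendsto_power cnorm_cls_limit X)
    then show ?thesis
      using X cnorm_cls_limit[OF cauchy_mult[OF cauchy_adj[OF X(1)] X(1)]] LIMSEQ_unique
      by (auto simp: cls_ops cauchy_ops)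
  qed
  show "\<exists>x\<in>carrier ?A. (\<lambda>n::nat. cnorm ?A (X n \<ominus>\<^bsub>?A\<^esub> x)) \<longlonglongrightarrow> 0"
    if "\<And>n. X n \<in> carrier ?A"
      "\<forall>e>0. \<exists>M. \<forall>m\<ge>M. \<forall>n\<ge>M. cnorm ?A (X m \<ominus>\<^bsub>?A\<^esub> X n) < e" for X
    using complete_aux that by blast
qed (auto elim!: carrierE simp: cls_ops cauchy_ops cls_closed free_scale_simps free_adj_add
    free_adj_scale free_adj_mult free_scale_mult_left free_scale_mult_right)

end


lemma relation_seminormsD:
  "p \<in> relation_seminorms R \<Longrightarrow> seminormed_star_algebra p"
  "p \<in> relation_seminorms R \<Longrightarrow> r \<in> R \<Longrightarrow> p r = 0"
  by (auto simp: relation_seminorms_def seminormed_star_algebra_def)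

lemma zero_relation_seminorm: "(\<lambda>x. 0) \<in> relation_seminorms R"
  by (simp add: relation_seminorms_def cstar_seminorm_def)

lemma universal_seminorm_upper:
  assumes "\<And>x. bdd_above ((\<lambda>p. p x) ` relation_seminorms R)" "p \<in> relation_seminorms R"
  shows "p x \<le> universal_seminorm R x"
  unfolding universal_seminorm_def by (rule cSUP_upper[OF assms(2,1)])

lemma universal_seminorm_least:
  assumes "\<And>p. p \<in> relation_seminorms R \<Longrightarrow> p x \<le> B"
  shows "universal_seminorm R x \<le> B"
  unfolding universal_seminorm_def using zero_relation_seminorm assms by (intro cSUP_least) auto

lemma universal_seminorm_mem:
  assumes bdd: "\<And>x. bdd_above ((\<lambda>p. p x) ` relation_seminorms R)"
  shows "universal_seminorm R \<in> relation_seminorms R"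
proof -
  let ?U = "universal_seminorm R"
  note upper = universal_seminorm_upper[OF bdd]
  have nonneg: "0 \<le> ?U x" for x using upper[OF zero_relation_seminorm] .
  have "?U (x + y) \<le> ?U x + ?U y" for x y
  proof (rule universal_seminorm_least)
    fix p assume p: "p \<in> relation_seminorms R"
    then show "p (x + y) \<le> ?U x + ?U y"
      using seminormed_star_algebra.p_add[OF relation_seminormsD(1)[OF p], of x y]
        upper[OF p, of x] upper[OF p, of y] by linarith
  qed
  moreover have scale_le: "?U (free_scale c x) \<le> cmod c * ?U x" for c x
  proof (rule universal_seminorm_least)
    fix p assume p: "p \<in> relation_seminorms R"
    then show "p (free_scale c x) \<le> cmod c * ?U x"
      using seminormed_star_algebra.p_scale[OF relation_seminormsD(1)[OF p], of c x]
        mult_left_mono[OF upper[OF p, of x], of "cmod c"] by simp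
  qed
  moreover have "cmod c * ?U x \<le> ?U (free_scale c x)" for c x
  proof (cases "c = 0")
    case False
    then show ?thesis
      using scale_le[of "inverse c" "free_scale c x"]
      by (simp add: free_scale_simps(3,4) norm_inverse field_simps del: norm_divide)
         (simp add: norm_divide field_simps)
  qed (simp add: nonneg)
  moreover have "?U (x * y) \<le> ?U x * ?U y" for x y
  proof (rule universal_seminorm_least)
    fix p assume p: "p \<in> relation_seminorms R"
    interpret seminormed_star_algebra p using p by (rule relation_seminormsD)
    show "p (x * y) \<le> ?U x * ?U y"
      using p_mult[of x y] mult_mono[OF upper[OF p, of x] upper[OF p, of y]] nonneg by force
  qed
  moreover have "?U (free_adj x * x) \<le> (?U x)\<^sup>2" for x
  proof (rule universal_seminorm_least)
    fix p assume p: "p \<in> relation_seminorms R"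
    interpret seminormed_star_algebra p using p by (rule relation_seminormsD)
    show "p (free_adj x * x) \<le> (?U x)\<^sup>2"
      unfolding p_cstar by (rule power_mono[OF upper[OF p]]) simp
  qed
  moreover have "(?U x)\<^sup>2 \<le> ?U (free_adj x * x)" for x
  proof -
    have "?U x \<le> sqrt (?U (free_adj x * x))"
    proof (rule universal_seminorm_least)
      fix p assume p: "p \<in> relation_seminorms R"
      interpret seminormed_star_algebra p using p by (rule relation_seminormsD)
      show "p x \<le> sqrt (?U (free_adj x * x))"
        using upper[OF p, of "free_adj x * x"] by (intro real_le_rsqrt) (simp add: p_cstar)
    qed
    then have "(?U x)\<^sup>2 \<le> (sqrt (?U (free_adj x * x)))\<^sup>2" using nonneg by (rule power_mono)
    then show ?thesis using nonneg by simp
  qed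
  moreover have "?U r = 0" if "r \<in> R" for r
    using that nonneg[of r] universal_seminorm_least[of R r 0] relation_seminormsD(2) by force
  ultimately show ?thesis
    by (auto simp: relation_seminorms_def cstar_seminorm_def intro!: antisym)
qed

lemma car_relationsI:
  "free_gen (\<alpha> *\<^sub>C \<xi> + \<beta> *\<^sub>C \<eta>) - (free_scale \<alpha> (free_gen \<xi>) + free_scale \<beta> (free_gen \<eta>))
     \<in> car_relations \<Gamma>"
  "free_gen (\<Gamma> \<xi>) - free_adj (free_gen \<xi>) \<in> car_relations \<Gamma>"
  "free_gen \<xi> * free_adj (free_gen \<eta>) + free_adj (free_gen \<eta>) * free_gen \<xi>
     - free_scale (cinner \<xi> \<eta>) 1 \<in> car_relations \<Gamma>"
  unfolding car_relations_def by blast+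

lemma car_gen_bound:
  assumes "p \<in> relation_seminorms (car_relations \<Gamma>)"
  shows "p (free_gen \<xi>) \<le> 1 + cmod (cinner \<xi> \<xi>) + cmod (cinner \<xi> (\<Gamma> \<xi>))"
proof -
  interpret seminormed_star_algebra p using assms by (rule relation_seminormsD)
  define x where "x = free_gen \<xi>"
  define y where "y = free_adj x"
  define z where "z = free_adj (free_gen (\<Gamma> \<xi>))"
  define c where "c = cinner \<xi> \<xi>"
  define d where "d = cinner \<xi> (\<Gamma> \<xi>)"
  have rel: "p r = 0" if "r \<in> car_relations \<Gamma>" for r
    using assms that by (rule relation_seminormsD)
  have one: "p 1 \<le> 1"
    using p_cstar[of 1] by (cases "p 1 = 0") (auto simp: power2_eq_square)
  have anti: "p (x * y + y * x - free_scale c 1) = 0"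
    unfolding x_def y_def c_def by (intro rel car_relationsI)
  have "p (x * z + z * x - free_scale d 1) = 0"
    unfolding x_def z_def d_def by (intro rel car_relationsI)
  moreover have xz: "p (x - z) = 0"
  proof -
    have "p (free_gen (\<Gamma> \<xi>) - free_adj x) = 0"
      unfolding x_def by (intro rel car_relationsI)
    then have "p (free_adj (free_gen (\<Gamma> \<xi>) - free_adj x)) = 0" by (simp add: p_adj)
    then show ?thesis by (simp add: free_adj_diff z_def p_commute[of x])
  qed
  moreover have "x * x + x * x = x * (x - z) + (x - z) * x + (x * z + z * x - free_scale d 1) + free_scale d 1"
    by (simp add: algebra_simps)
  ultimately have "p (x * x + x * x) \<le> cmod d * p 1"
    using p_add[of "x * (x - z) + (x - z) * x + (x * z + z * x - free_scale d 1)" "free_scale d 1"]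
      p_add[of "x * (x - z) + (x - z) * x" "x * z + z * x - free_scale d 1"]
      p_add[of "x * (x - z)" "(x - z) * x"] p_mult[of x "x - z"] p_mult[of "x - z" x]
    by (simp add: p_scale)
  moreover have "x * x + x * x = free_scale 2 (x * x)"
    using free_scale_simps(2)[of 1 1 "x * x"] by (simp add: free_scale_simps(4))
  ultimately have "2 * p (x * x) \<le> cmod d * p 1" by (simp add: p_scale)
  then have xx: "p (x * x) \<le> cmod d"
    using mult_left_mono[OF one norm_ge_zero[of d]] p_nonneg[of "x * x"] by linarith
  have yy: "p (y * y) = p (x * x)"
    using p_adj[of "x * x"] by (simp add: free_adj_mult y_def)
  define h where "h = y * x"
  have "h * h = y * (x * y + y * x - free_scale c 1) * x + (free_scale c h - (y * y) * (x * x))"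
    by (simp add: h_def algebra_simps free_scale_mult_left free_scale_mult_right)
  then have "p (h * h) \<le> p (y * (x * y + y * x - free_scale c 1) * x) + (p (free_scale c h) + p ((y * y) * (x * x)))"
    using p_add[of "y * (x * y + y * x - free_scale c 1) * x" "free_scale c h - (y * y) * (x * x)"]
      p_add[of "free_scale c h" "- ((y * y) * (x * x))"] by (simp add: p_minus)
  moreover have "p (y * (x * y + y * x - free_scale c 1) * x) \<le> 0"
    using p_mult[of "y * (x * y + y * x - free_scale c 1)" x]
      mult_right_mono[OF p_mult[of y "x * y + y * x - free_scale c 1"], of "p x"] anti by simp
  moreover have "p ((y * y) * (x * x)) \<le> cmod d * cmod d"
    using p_mult[of "y * y" "x * x"] mult_mono[OF xx xx] yy by simp
  moreover have "p (h * h) = (p h)\<^sup>2"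
    using p_cstar[of h] by (simp add: h_def y_def free_adj_mult)
  ultimately have quad: "(p h)\<^sup>2 \<le> cmod c * p h + cmod d * cmod d" by (simp add: p_scale)
  have ph: "p h \<le> cmod c + cmod d"
  proof (rule ccontr)
    assume "\<not> p h \<le> cmod c + cmod d"
    then have gt: "p h > cmod c + cmod d" by simp
    then have pos: "p h > 0" using norm_ge_zero[of c] norm_ge_zero[of d] by linarith
    have "cmod d * cmod d \<le> cmod d * p h"
    proof (rule mult_left_mono)
      show "cmod d \<le> p h" using gt norm_ge_zero[of c] by linarith
    qed simp
    then have "(p h)\<^sup>2 \<le> (cmod c + cmod d) * p h" using quad by (simp add: algebra_simps)
    then show False using gt pos by (simp add: power2_eq_square)
  qed
  have "(p x)\<^sup>2 = p h" using p_cstar[of x] by (simp add: h_def y_def)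
  then have "(p x)\<^sup>2 \<le> (1 + cmod c + cmod d)\<^sup>2"
    using ph norm_ge_zero[of c] norm_ge_zero[of d]
      self_le_power[of "1 + cmod c + cmod d" 2] by simp
  then have "p x \<le> 1 + cmod c + cmod d"
    by (rule power2_le_imp_le) simp
  then show ?thesis by (simp add: x_def c_def d_def)
qed

lemma car_seminorms_bdd: "bdd_above ((\<lambda>p. p x) ` relation_seminorms (car_relations \<Gamma>))"
proof -
  let ?P = "relation_seminorms (car_relations \<Gamma>)"
  have word: "\<exists>B. \<forall>p\<in>?P. p (Poly_Mapping.single (Star_Word l) 1) \<le> B" for l
  proof (induction l)
    case Nil
    have "p 1 \<le> 1" if "p \<in> ?P" for p
      using seminormed_star_algebra.p_cstar[OF relation_seminormsD(1)[OF that], of 1]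
      by (cases "p 1 = 0") (auto simp: power2_eq_square)
    then show ?case by (auto simp flip: zero_star_word_def)
  next
    case (Cons a l)
    obtain \<xi> s where a: "a = (\<xi>, s)" by (cases a)
    obtain B where B: "\<And>p. p \<in> ?P \<Longrightarrow> p (Poly_Mapping.single (Star_Word l) 1) \<le> B"
      using Cons.IH by blast
    define x where "x = (if s then free_adj (free_gen \<xi>) else free_gen \<xi>)"
    have split: "Poly_Mapping.single (Star_Word (a # l)) 1 = x * Poly_Mapping.single (Star_Word l) 1"
      by (simp add: x_def a free_gen_def free_adj_single mult_single plus_star_word_def word_adj_def)
    let ?K = "1 + cmod (cinner \<xi> \<xi>) + cmod (cinner \<xi> (\<Gamma> \<xi>))"
    have "p (Poly_Mapping.single (Star_Word (a # l)) 1) \<le> ?K * B" if p: "p \<in> ?P" for p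
    proof -
      interpret seminormed_star_algebra p using p by (rule relation_seminormsD)
      have "p x \<le> ?K" using car_gen_bound[OF p] by (simp add: x_def p_adj)
      then show ?thesis
        unfolding split using p_mult mult_mono[OF _ B[OF p]] by (meson order_trans p_nonneg)
    qed
    then show ?case by blast
  qed
  have "\<exists>B. \<forall>p\<in>?P. p x \<le> B"
  proof (induction x rule: free_induct)
    case zero
    have "p 0 \<le> 0" if "p \<in> ?P" for p
      using seminormed_star_algebra.p_0[OF relation_seminormsD(1)[OF that]] by simp
    then show ?case by blast
  next
    case (single w c)
    obtain B where B: "\<And>p. p \<in> ?P \<Longrightarrow> p (Poly_Mapping.single w 1) \<le> B"
      using word[of "letters w"] by auto
    have "Poly_Mapping.single w c = free_scale c (Poly_Mapping.single w 1)"
      by (simp add: free_scale_conv_mult mult_single)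
    then have "p (Poly_Mapping.single w c) \<le> cmod c * B" if "p \<in> ?P" for p
      using seminormed_star_algebra.p_scale[OF relation_seminormsD(1)[OF that]] B[OF that]
      by (simp add: mult_left_mono)
    then show ?case by blast
  next
    case (add x y)
    then obtain B C where BC: "\<And>p. p \<in> ?P \<Longrightarrow> p x \<le> B" "\<And>p. p \<in> ?P \<Longrightarrow> p y \<le> C" by blast
    have "p (x + y) \<le> B + C" if p: "p \<in> ?P" for p
      using seminormed_star_algebra.p_add[OF relation_seminormsD(1)[OF p], of x y] BC[OF p]
      by linarith
    then show ?case by blast
  qed
  then show ?thesis by (auto simp: bdd_above_def)
qed

context
  fixes \<Gamma> :: "'h::chilbert_space \<Rightarrow> 'h"
begin

interpretation seminormed_star_algebra "universal_seminorm (car_relations \<Gamma>)"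
  using universal_seminorm_mem[OF car_seminorms_bdd] by (rule relation_seminormsD)

lemma cls_eqI_relation:
  "x - y \<in> car_relations \<Gamma> \<Longrightarrow> cls (\<lambda>n. x) = cls (\<lambda>n. y)"
  using relation_seminormsD(2)[OF universal_seminorm_mem[OF car_seminorms_bdd], of "x - y" \<Gamma>]
  by (simp add: cls_eq_iff)

theorem cstar_algebra_car: "cstar_algebra (car_algebra \<Gamma>)"
  unfolding car_algebra_def universal_cstar_def by (rule cstar_algebra_completion)

theorem car_gen_closed: "car_gen \<Gamma> \<xi> \<in> carrier (car_algebra \<Gamma>)"
  by (simp add: car_algebra_def universal_cstar_def car_gen_def universal_gen_def cls_closed)

theorem car_gen_linear:
  "car_gen \<Gamma> (\<alpha> *\<^sub>C \<xi> + \<beta> *\<^sub>C \<eta>) =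
     \<alpha> \<odot>\<^bsub>car_algebra \<Gamma>\<^esub> car_gen \<Gamma> \<xi> \<oplus>\<^bsub>car_algebra \<Gamma>\<^esub> \<beta> \<odot>\<^bsub>car_algebra \<Gamma>\<^esub> car_gen \<Gamma> \<eta>"
  unfolding car_algebra_def universal_cstar_def car_gen_def universal_gen_def
  by (simp add: cls_ops cauchy_const) (intro cls_eqI_relation car_relationsI)

theorem car_gen_conj: "car_gen \<Gamma> (\<Gamma> \<xi>) = adj (car_algebra \<Gamma>) (car_gen \<Gamma> \<xi>)"
  unfolding car_algebra_def universal_cstar_def car_gen_def universal_gen_def
  by (simp add: cls_ops cauchy_const) (intro cls_eqI_relation car_relationsI)

theorem car_anticommutation:
  "car_gen \<Gamma> \<xi> \<otimes>\<^bsub>car_algebra \<Gamma>\<^esub> adj (car_algebra \<Gamma>) (car_gen \<Gamma> \<eta>) \<oplus>\<^bsub>car_algebra \<Gamma>\<^esub>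
     adj (car_algebra \<Gamma>) (car_gen \<Gamma> \<eta>) \<otimes>\<^bsub>car_algebra \<Gamma>\<^esub> car_gen \<Gamma> \<xi> =
   cinner \<xi> \<eta> \<odot>\<^bsub>car_algebra \<Gamma>\<^esub> \<one>\<^bsub>car_algebra \<Gamma>\<^esub>"
  unfolding car_algebra_def universal_cstar_def car_gen_def universal_gen_def
  by (simp add: cls_ops cauchy_const) (intro cls_eqI_relation car_relationsI)

end

end

theory Submission
  imports Defs
begin

text \<open>Polarization makes a covariance operator \<open>S\<close> self-adjoint, and then \<open>\<Gamma> S = (1 - S) \<Gamma>\<close> gives
  \<open>(S \<xi>, \<Gamma> \<xi>) = (\<xi>, \<Gamma> S \<xi>) = (\<xi>, \<Gamma> \<xi>) - (S \<xi>, \<Gamma> \<xi>)\<close>. Hence \<open>(S \<xi>, \<Gamma> \<xi>) = (\<xi>, \<Gamma> \<xi>) / 2\<close> for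
  every covariance operator: the CAR already fix the value of a state on \<open>b(\<xi>)\<^sup>2\<close>.\<close>

lemma cinner_add_right: "cinner x (y + z) = cinner x y + cinner x z"
  by (metis cinner_add_left cinner_commute complex_cnj_add)

lemma cinner_scaleC_right: "cinner x (a *\<^sub>C y) = cnj a * cinner x y"
  by (metis cinner_commute cinner_scaleC_left complex_cnj_mult)

lemma cinner_diff_right: "cinner x (y - z) = cinner x y - cinner x z"
  using cinner_add_right[of x "y - z" z] by simp

lemma positive_operator_selfadjoint:
  assumes "positive_operator T"
  shows "cinner (T x) y = cinner x (T y)"
proof -
  have T_add: "T (u + v) = T u + T v" and T_scale: "T (a *\<^sub>C u) = a *\<^sub>C T u" for u v a
    using assms by (auto simp: positive_operator_def bounded_clinear_def linear_simps)
  \<comment> \<open>The order on complex numbers makes \<open>0 \<le> z\<close> include that z is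
    real.\<close>
  have real: "Im (cinner (T u) u) = 0" for u
    using assms by (simp add: positive_operator_def less_eq_complex_def)
  have "Im (cinner (T x) y) = - Im (cinner (T y) x)"
    using real[of "x + y"] real[of x] real[of y]
    by (simp add: T_add cinner_add_left cinner_add_right)
  \<comment> \<open>The factor \<open>\<i>\<close> turns the real parts of the cross terms into
    imaginary parts, which must cancel.\<close>
  moreover have "Re (cinner (T x) y) = Re (cinner (T y) x)"
    using real[of "x + \<i> *\<^sub>C y"] real[of x] real[of y]
    by (simp add: T_add T_scale cinner_add_left cinner_add_right cinner_scaleC_left
        cinner_scaleC_right)
  ultimately have "cinner (T x) y = cnj (cinner (T y) x)" by (simp add: complex_eq_iff)
  then show ?thesis by (simp flip: cinner_commute)
qed

lemma covariance_operator_diagonal: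
  assumes \<Gamma>: "antiunitary_involution \<Gamma>" and S: "covariance_operator \<Gamma> S"
  shows "cinner (S \<xi>) (\<Gamma> \<xi>) = cinner \<xi> (\<Gamma> \<xi>) / 2"
proof -
  have selfadjoint: "cinner (S x) y = cinner x (S y)" for x y
    using S by (intro positive_operator_selfadjoint) (simp add: covariance_operator_def)
  have "cinner (S \<xi>) (\<Gamma> \<xi>) = cinner (\<Gamma> (\<Gamma> \<xi>)) (\<Gamma> (S \<xi>))"
    using \<Gamma> unfolding antiunitary_involution_def by metis
  \<comment> \<open>Keeping the double \<open>\<Gamma>\<close> under S exposes
    \<open>\<Gamma> S \<Gamma>\<close>, applied to \<open>\<Gamma> \<xi>\<close>, so that the
    covariance identity applies.\<close>
  also have "\<dots> = cinner \<xi> (\<Gamma> (S (\<Gamma> (\<Gamma> \<xi>))))"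
    using \<Gamma> by (simp add: antiunitary_involution_def)
  also have "\<dots> = cinner \<xi> (\<Gamma> \<xi> - S (\<Gamma> \<xi>))"
    using S by (simp add: covariance_operator_def)
  also have "\<dots> = cinner \<xi> (\<Gamma> \<xi>) - cinner (S \<xi>) (\<Gamma> \<xi>)"
    by (simp add: cinner_diff_right selfadjoint)
  finally show ?thesis by (simp add: mult.commute)
qed

theorem theorem3p1:
  fixes \<Gamma> S S' :: "'h::chilbert_space \<Rightarrow> 'h"
  assumes "antiunitary_involution \<Gamma>"
    and "covariance_operator \<Gamma> S"
    and "covariance_operator \<Gamma> S'"
    and "affine_property \<Gamma> S S'"
  shows "\<forall>\<xi>. cinner (S \<xi>) (\<Gamma> \<xi>) = cinner (S' \<xi>) (\<Gamma> \<xi>)"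
  using assms by (simp add: covariance_operator_diagonal)

end
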